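(* Let $\mathscr{A}$ be an irreducible arrangement in a $2$-dimensional vector space over $\mathbb{K}$ and let $m:\mathscr{A}\to\mathbb{Z}_{\ge 0}$ be a multiplicity. Assume that $|\mathscr{A}|>3$, or that $|\mathscr{A}|=3$ and $m$ is balanced. Then a homogeneous derivation $\theta\in D(\mathscr{A},m+\mathbf{1})$ is $m$-universal if and only if $m+\mathbf{1}$ is balanced and $\exp(\mathscr{A},m+\mathbf{1})=(\deg\theta,\ \deg\theta+|\mathscr{A}|-2)$.
   Context: $\mathbb{K}$ is a field of characteristic zero, $V$ an $\ell$-dimensional $\mathbb{K}$-vector space (here $\ell=2$), $S=\mathbb{K}[x_1,\ldots,x_\ell]$ its coordinate ring, $\mathrm{Der}_S=\bigoplus_{i}S\,\partial_{x_i}$. A (central) arrangement $\mathscr{A}$ is a finite set of linear hyperplanes in $V$, assumed essential: $\bigcap_{H\in\mathscr{A}}H=\{0\}$. It is irreducible if it is not, after a linear change of coordinates, a product of two arrangements in nonzero spaces $V_1,V_2$ with $V=V_1\oplus V_2$ (for $\ell=2$ this means $|\mathscr{A}|\geq 3$). For $H\in\mathscr{A}$ fix $\alpha_H\in V^*$ with $\ker\alpha_H=H$. A multiplicity is a map $m:\mathscr{A}\to\mathbb{Z}_{\ge 0}$; $\mathbf{1}$ is the multiplicity with constant value $1$. $D(\mathscr{A},m)=\{\theta\in\mathrm{Der}_S\mid\theta(\alpha_H)\in S\alpha_H^{m(H)}\ \forall H\in\mathscr{A}\}$. A nonzero derivation $\theta$ is homogeneous of degree $k$ if every nonzero $\theta(\alpha)$,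 $\alpha\in V^*$, is a homogeneous polynomial of degree $k$. $(\mathscr{A},m)$ is free if $D(\mathscr{A},m)$ is a free $S$-module; then $\exp(\mathscr{A},m)$ is the tuple of degrees (up to order) of a homogeneous basis. For $\ell=2$ every $(\mathscr{A},m)$ is free. For $\varphi\in\mathrm{Der}_S$ and $\theta=\sum_i f_i\partial_{x_i}$ put $\nabla_\varphi\theta=\sum_i\varphi(f_i)\partial_{x_i}$. A homogeneous $\theta\in D(\mathscr{A},m+\mathbf{1})$ is $m$-universal if $\mathrm{Der}_S\to D(\mathscr{A},m)$, $\varphi\mapsto\nabla_\varphi\theta$, is an isomorphism of $S$-modules. A multiplicity $m$ is balanced if $m(H)\le\sum_{H'\in\mathscr{A}\setminus\{H\}}m(H')$ for all $H\in\mathscr{A}$. *)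

theory Defs
  imports
    Complex_Main
    "HOL-Computational_Algebra.Polynomial"
    "HOL-Library.Multiset"
    "HOL-Library.Product_Plus"
    "HOL-Library.Set_Algebras"
begin

section \<open>Arrangements of hyperplanes\<close>

locale arrangement_space = vector_space scale
  for scale :: "'a::field \<Rightarrow> 'b::ab_group_add \<Rightarrow> 'b"
begin

definition linear_form :: "('b \<Rightarrow> 'a) \<Rightarrow> bool" where
  "linear_form f \<longleftrightarrow> Vector_Spaces.linear scale (*) f"

definition hyperplane_of :: "'b set \<Rightarrow> 'b set \<Rightarrow> bool" where
  "hyperplane_of W H \<longleftrightarrow> subspace H \<and> H \<subseteq> W \<and> dim H + 1 = dim W"

text \<open>Central essential arrangements in a subspace \<open>W\<close>.  The intersection over
  the empty arrangement is \<open>W\<close> itself.\<close>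

definition arrangement :: "'b set \<Rightarrow> 'b set set \<Rightarrow> bool" where
  "arrangement W \<A> \<longleftrightarrow> finite \<A> \<and> (\<forall>H\<in>\<A>. hyperplane_of W H) \<and> W \<inter> \<Inter>\<A> = {0}"

text \<open>\<open>H + V2\<close> is the Minkowski sum of sets.  Ranging over all internal
  decompositions of the whole space takes care of linear changes of coordinates.\<close>

definition product_arrangement ::
    "'b set \<Rightarrow> 'b set set \<Rightarrow> 'b set \<Rightarrow> 'b set set \<Rightarrow> 'b set set" where
  "product_arrangement V1 \<A>1 V2 \<A>2 = {H + V2 | H. H \<in> \<A>1} \<union> {V1 + H | H. H \<in> \<A>2}"

definition irreducible_arrangement :: "'b set set \<Rightarrow> bool" where
  "irreducible_arrangement \<A> \<longleftrightarrow> arrangement UNIV \<A> \<and>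
     \<not> (\<exists>V1 V2 \<A>1 \<A>2. subspace V1 \<and> subspace V2 \<and> V1 \<noteq> {0} \<and> V2 \<noteq> {0} \<and>
          V1 \<inter> V2 = {0} \<and> V1 + V2 = UNIV \<and>
          arrangement V1 \<A>1 \<and> arrangement V2 \<A>2 \<and>
          \<A> = product_arrangement V1 \<A>1 V2 \<A>2)"

definition defining_forms :: "'b set set \<Rightarrow> ('b set \<Rightarrow> 'b \<Rightarrow> 'a) \<Rightarrow> bool" where
  "defining_forms \<A> \<alpha> \<longleftrightarrow> (\<forall>H\<in>\<A>. linear_form (\<alpha> H) \<and> {v. \<alpha> H v = 0} = H)"

end

text \<open>Multiplicities are total functions on sets; only their values on the
  arrangement matter.\<close>

definition balanced :: "'b set set \<Rightarrow> ('b set \<Rightarrow> nat) \<Rightarrow> bool" where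
  "balanced \<A> m \<longleftrightarrow> (\<forall>H\<in>\<A>. m H \<le> (\<Sum>H'\<in>\<A> - {H}. m H'))"


section \<open>The polynomial ring in two variables and its derivations\<close>

text \<open>\<open>K[x\<^sub>1, x\<^sub>2]\<close> is \<open>K[x\<^sub>1][x\<^sub>2]\<close>: the inner polynomial variable is
  \<open>x\<^sub>1\<close>, the outer one is \<open>x\<^sub>2\<close>.\<close>

type_synonym 'k bipoly = "'k poly poly"

definition X1 :: "'k::field bipoly" where "X1 = [:[:0, 1:]:]"
definition X2 :: "'k::field bipoly" where "X2 = [:0, 1:]"

definition Const :: "'k::field \<Rightarrow> 'k bipoly" where "Const c = [:[:c:]:]"

definition partial1 :: "'k::field bipoly \<Rightarrow> 'k bipoly" where "partial1 p = map_poly pderiv p"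
definition partial2 :: "'k::field bipoly \<Rightarrow> 'k bipoly" where "partial2 p = pderiv p"

text \<open>The zero polynomial is homogeneous of every degree.\<close>

definition homogeneous_poly :: "nat \<Rightarrow> 'k::field bipoly \<Rightarrow> bool" where
  "homogeneous_poly k p \<longleftrightarrow> (\<forall>i j. coeff (coeff p j) i \<noteq> 0 \<longrightarrow> i + j = k)"

text \<open>The pair \<open>(f\<^sub>1, f\<^sub>2)\<close> stands for the derivation \<open>f\<^sub>1 \<partial>\<^sub>1 + f\<^sub>2 \<partial>\<^sub>2\<close>.\<close>

type_synonym 'k der = "'k bipoly \<times> 'k bipoly"

definition der_apply :: "'k::field der \<Rightarrow> 'k bipoly \<Rightarrow> 'k bipoly" where
  "der_apply \<theta> p = fst \<theta> * partial1 p + snd \<theta> * partial2 p"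

definition der_scale :: "'k::field bipoly \<Rightarrow> 'k der \<Rightarrow> 'k der" where
  "der_scale s \<theta> = (s * fst \<theta>, s * snd \<theta>)"

global_interpretation der: module "der_scale :: 'k::field bipoly \<Rightarrow> 'k der \<Rightarrow> 'k der"
  by unfold_locales (auto simp: der_scale_def algebra_simps prod_eq_iff)

definition nabla :: "'k::field der \<Rightarrow> 'k der \<Rightarrow> 'k der" where
  "nabla \<phi> \<theta> = (der_apply \<phi> (fst \<theta>), der_apply \<phi> (snd \<theta>))"


section \<open>Logarithmic derivations of multiarrangements in a plane\<close>

text \<open>A two-dimensional vector space with a basis \<open>e1, e2\<close>; the variables
  \<open>x\<^sub>1, x\<^sub>2\<close> are the coordinates with respect to this basis.\<close>

locale coordinate_plane = arrangement_space scale
  for scale :: "'k::field_char_0 \<Rightarrow> 'v::ab_group_add \<Rightarrow> 'v" +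
  fixes e1 e2 :: 'v
  assumes distinct_basis: "e1 \<noteq> e2"
    and independent_basis: "independent {e1, e2}"
    and span_basis: "span {e1, e2} = UNIV"
begin

text \<open>The linear form \<open>f\<close> as an element of the coordinate ring.\<close>

definition form_poly :: "('v \<Rightarrow> 'k) \<Rightarrow> 'k bipoly" where
  "form_poly f = Const (f e1) * X1 + Const (f e2) * X2"

definition homogeneous_der :: "'k der \<Rightarrow> nat \<Rightarrow> bool" where
  "homogeneous_der \<theta> k \<longleftrightarrow> \<theta> \<noteq> 0 \<and>
     (\<forall>f. linear_form f \<and> der_apply \<theta> (form_poly f) \<noteq> 0 \<longrightarrow>
          homogeneous_poly k (der_apply \<theta> (form_poly f)))"

definition log_der :: "'v set set \<Rightarrow> ('v set \<Rightarrow> 'v \<Rightarrow> 'k) \<Rightarrow> ('v set \<Rightarrow> nat) \<Rightarrow> 'k der set" where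
  "log_der \<A> \<alpha> m =
     {\<theta>. \<forall>H\<in>\<A>. form_poly (\<alpha> H) ^ m H dvd der_apply \<theta> (form_poly (\<alpha> H))}"

text \<open>The module of logarithmic derivations is free with a homogeneous basis whose
  degrees form the multiset \<open>E\<close>.\<close>

definition has_exponents ::
    "'v set set \<Rightarrow> ('v set \<Rightarrow> 'v \<Rightarrow> 'k) \<Rightarrow> ('v set \<Rightarrow> nat) \<Rightarrow> nat multiset \<Rightarrow> bool" where
  "has_exponents \<A> \<alpha> m E \<longleftrightarrow>
     (\<exists>B \<delta>. finite B \<and> der.independent B \<and> der.span B = log_der \<A> \<alpha> m \<and>
            (\<forall>\<theta>\<in>B. homogeneous_der \<theta> (\<delta> \<theta>)) \<and> E = image_mset \<delta> (mset_set B))"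

definition universal_der ::
    "'v set set \<Rightarrow> ('v set \<Rightarrow> 'v \<Rightarrow> 'k) \<Rightarrow> ('v set \<Rightarrow> nat) \<Rightarrow> 'k der \<Rightarrow> bool" where
  "universal_der \<A> \<alpha> m \<theta> \<longleftrightarrow>
     (\<exists>k. homogeneous_der \<theta> k) \<and> \<theta> \<in> log_der \<A> \<alpha> (\<lambda>H. m H + 1) \<and>
     module_hom der_scale der_scale (\<lambda>\<phi>. nabla \<phi> \<theta>) \<and>
     bij_betw (\<lambda>\<phi>. nabla \<phi> \<theta>) UNIV (log_der \<A> \<alpha> m)"

end

end

theory Submission
  imports Defs "HOL-Computational_Algebra.Factorial_Ring"
begin

text \<open>
  The proof rests on Saito's criterion in two variables.  Let \<open>Q m\<close> be the product of the
  linear forms \<open>\<alpha> H\<close>, each raised to the power \<open>m H\<close>.  The determinant of any two elements of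
  \<open>D(\<A>, m)\<close> is divisible by \<open>Q m\<close>.  If the two elements generate the module, the determinant is
  \<open>Q m\<close> up to a unit (\<open>der_det_generators\<close>), and if the determinant is a nonzero constant times
  \<open>Q m\<close>, they form a basis (\<open>basis_if_der_det\<close>, \<open>independent_if_der_det\<close>).  The derivations
  \<open>\<nabla>\<^sub>\<phi>\<theta>\<close> are the combinations of \<open>\<nabla>\<close> of \<open>\<theta>\<close> along the two coordinate fields, and the determinant
  of these two is the Jacobian \<open>J\<close> of the coefficients of \<open>\<theta>\<close>.  Hence \<open>\<theta>\<close> is universal if and only
  if \<open>J\<close> is a nonzero constant times \<open>Q m\<close>.  As \<open>Q m\<close> divides \<open>J\<close>, and \<open>J\<close> is homogeneous of degree
  \<open>2 (d - 1)\<close>, this means that \<open>J\<close> is nonzero and that \<open>m\<close> has the sum \<open>2 (d - 1)\<close>.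

  Suppose that \<open>\<theta>\<close> is universal.  For multiplicity one, there is the basis consisting of the Euler
  derivation and of \<open>gradient_perp\<close>, of degree \<open>card \<A> - 1\<close>.  Applying \<open>\<phi> \<mapsto> \<nabla>\<^sub>\<phi>\<theta>\<close> to it gives
  \<open>d \<theta>\<close> and an element of degree \<open>d + card \<A> - 2\<close>.  Both lie in \<open>D(\<A>, m + 1)\<close>, and their
  determinant is \<open>J\<close> times that of the original basis, thus a nonzero constant times \<open>Q (m + 1)\<close>
  (\<open>der_det_gradient_perp\<close>).  So they form a basis with the required degrees.  Moreover, \<open>D(\<A>, m)\<close>
  has no nonzero element of degree below \<open>d - 1\<close>, half the sum of \<open>m\<close>.  Since the constant field along \<open>H\<close> times
  the powers of the other linear forms lies in \<open>D(\<A>, m)\<close>, the multiplicity \<open>m\<close> is balanced, and so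
  is \<open>m + 1\<close> (\<open>balanced_if_jacobian_nonzero\<close>).

  Conversely, the exponents add up to the sum of \<open>m + 1\<close>, so \<open>m\<close> has the sum \<open>2 (d - 1)\<close>, and it
  remains to exclude \<open>J = 0\<close>.  In that case the coefficients of \<open>\<theta>\<close> are proportional over the field
  (\<open>homogeneous_linearly_dependent\<close>), so \<open>\<theta>\<close> is a multiple \<open>g\<close> of a constant field.  The polynomial
  \<open>g\<close> of degree \<open>d\<close> is then divisible by \<open>\<alpha> H\<close> to the power \<open>m H + 1\<close> for all \<open>H\<close> but at most one.
  As \<open>m + 1\<close> is balanced, these powers have a total degree of at least half of \<open>2 d + card \<A> - 2\<close>,
  which exceeds \<open>d\<close> (\<open>jacobian_nonzero_if_large_multiplicities\<close>).
\<close>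

section \<open>Partial derivatives and homogeneous polynomials\<close>

lemma Const_0 [simp]: "Const 0 = 0"
  by (simp add: Const_def)

lemma Const_1 [simp]: "Const 1 = 1"
  by (simp add: Const_def one_pCons)

lemma Const_add: "Const (x + y) = Const x + Const y"
  by (simp add: Const_def)

lemma Const_diff: "Const (x - y) = Const x - Const y"
  by (simp add: Const_def)

lemma Const_uminus: "Const (- x) = - Const x"
  by (simp add: Const_def)

lemma Const_mult: "Const (x * y) = Const x * Const y"
  by (simp add: Const_def)

lemma Const_eq_0_iff [simp]: "Const x = 0 \<longleftrightarrow> x = 0"
  by (simp add: Const_def)

lemma Const_of_nat: "Const (of_nat n) = of_nat n"
  by (simp add: Const_def of_nat_poly)

lemma Const_dvd_1 [simp]: "x \<noteq> 0 \<Longrightarrow> Const x dvd 1"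
  by (rule dvdI[of _ _ "Const (inverse x)"]) (simp flip: Const_mult)

lemma dvd_Const_mult_iff:
  assumes "c \<noteq> 0"
  shows "p dvd Const c * q \<longleftrightarrow> p dvd q"
  using assms by (simp add: dvd_mult_unit_iff')

lemma coeff_partial1: "coeff (partial1 p) j = pderiv (coeff p j)"
  by (simp add: partial1_def coeff_map_poly)

lemma partial1_add: "partial1 (p + q) = partial1 p + partial1 q"
  by (rule poly_eqI) (simp add: coeff_partial1 pderiv_add)

lemma partial2_add: "partial2 (p + q) = partial2 p + partial2 q"
  by (simp add: partial2_def pderiv_add)

lemma partial1_mult: "partial1 (p * q) = p * partial1 q + q * partial1 p"
proof (rule poly_eqI)
  fix n
  have "coeff (partial1 (p * q)) n =
      (\<Sum>i\<le>n. coeff p i * pderiv (coeff q (n - i)))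
      + (\<Sum>i\<le>n. pderiv (coeff p i) * coeff q (n - i))"
    by (simp add: coeff_partial1 coeff_mult higher_pderiv_sum [where n = 1, simplified]
        pderiv_mult sum.distrib mult.commute)
  also have "\<dots> = coeff (p * partial1 q + partial1 p * q) n"
    by (simp add: coeff_mult coeff_partial1)
  finally show "coeff (partial1 (p * q)) n = coeff (p * partial1 q + q * partial1 p) n"
    by (simp add: mult.commute)
qed

lemma partial2_mult: "partial2 (p * q) = p * partial2 q + q * partial2 p"
  by (simp add: partial2_def pderiv_mult)

lemma der_apply_add: "der_apply \<phi> (p + q) = der_apply \<phi> p + der_apply \<phi> q"
  by (simp add: der_apply_def partial1_add partial2_add algebra_simps)

lemma der_apply_mult: "der_apply \<phi> (p * q) = p * der_apply \<phi> q + q * der_apply \<phi> p"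
  by (simp add: der_apply_def partial1_mult partial2_mult algebra_simps)

lemma der_apply_Const [simp]: "der_apply \<phi> (Const c) = 0"
  by (simp add: der_apply_def Const_def partial1_def partial2_def map_poly_pCons)

lemma der_apply_plus: "der_apply (\<phi> + \<psi>) p = der_apply \<phi> p + der_apply \<psi> p"
  by (simp add: der_apply_def algebra_simps)

lemma der_apply_der_scale: "der_apply (der_scale s \<phi>) p = s * der_apply \<phi> p"
  by (simp add: der_apply_def der_scale_def algebra_simps)

lemma der_apply_Const_mult: "der_apply \<phi> (Const c * p) = Const c * der_apply \<phi> p"
  by (simp add: der_apply_mult)

lemma der_apply_X1 [simp]: "der_apply \<phi> X1 = fst \<phi>"
  by (simp add: der_apply_def X1_def partial1_def partial2_def map_poly_pCons pderiv_pCons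
      flip: one_pCons)

lemma der_apply_X2 [simp]: "der_apply \<phi> X2 = snd \<phi>"
  by (simp add: der_apply_def X2_def partial1_def partial2_def map_poly_pCons map_poly_1
      pderiv_pCons flip: one_pCons)

lemma der_apply_power: "der_apply \<phi> (p ^ Suc n) = of_nat (Suc n) * p ^ n * der_apply \<phi> p"
  by (induction n) (simp_all add: der_apply_mult algebra_simps)

text \<open>Differentiation lowers the order of divisibility by \<open>p\<close> by at most one.  A derivation that
  preserves the ideal of \<open>p\<close> does not lower it at all; that is the lemma after this one.\<close>

lemma power_dvd_der_apply:
  assumes "p ^ Suc n dvd q"
  shows "p ^ n dvd der_apply \<phi> q"
proof -
  obtain r where "q = p ^ Suc n * r"
    using assms by (rule dvdE)
  then have "der_apply \<phi> q =
      p ^ n * (p * der_apply \<phi> r + r * of_nat (Suc n) * der_apply \<phi> p)"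
    by (simp only: der_apply_mult der_apply_power) (simp add: algebra_simps)
  then show ?thesis by simp
qed

lemma power_dvd_der_apply_log:
  assumes "p ^ n dvd q" and "p dvd der_apply \<phi> p"
  shows "p ^ n dvd der_apply \<phi> q"
proof (cases n)
  case (Suc k)
  obtain r where r: "q = p ^ Suc k * r"
    using assms Suc by (auto elim: dvdE)
  obtain s where s: "der_apply \<phi> p = p * s"
    using assms(2) by (rule dvdE)
  have "der_apply \<phi> q = p ^ Suc k * (der_apply \<phi> r + r * of_nat (Suc k) * s)"
    unfolding r by (simp only: der_apply_mult der_apply_power s) (simp add: algebra_simps)
  then show ?thesis
    using Suc by simp
qed simp

text \<open>The Euler derivation \<open>x\<^sub>1 \<partial>\<^sub>1 + x\<^sub>2 \<partial>\<^sub>2\<close>.  In characteristic zero its eigenspaces are the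
  homogeneous polynomials of a given degree, and most facts on homogeneity below are obtained
  from this characterization.\<close>

definition euler :: "'k::field der" where
  "euler = (X1, X2)"

lemma coeff_X1_mult: "coeff (coeff (X1 * p) j) i = (if i = 0 then 0 else coeff (coeff p j) (i - 1))"
  by (auto simp: X1_def coeff_pCons split: nat.splits)

lemma coeff_X2_mult: "coeff (coeff (X2 * p) j) i = (if j = 0 then 0 else coeff (coeff p (j - 1)) i)"
  by (auto simp: X2_def coeff_pCons split: nat.splits)

lemma coeff_Const_mult: "coeff (coeff (Const c * p) j) i = c * coeff (coeff p j) i"
  by (simp add: Const_def)

lemma coeff_euler:
  "coeff (coeff (der_apply euler p) j) i = of_nat (i + j) * coeff (coeff p j) i"
  by (auto simp: der_apply_def euler_def coeff_X1_mult coeff_X2_mult coeff_partial1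
      partial2_def coeff_pderiv algebra_simps of_nat_poly gr0_conv_Suc simp flip: of_nat_Suc)

lemma homogeneous_poly_iff_euler:
  fixes p :: "'k::field_char_0 bipoly"
  shows "homogeneous_poly k p \<longleftrightarrow> der_apply euler p = of_nat k * p"
proof -
  have "der_apply euler p = of_nat k * p \<longleftrightarrow>
      (\<forall>j i. of_nat (i + j) * coeff (coeff p j) i = of_nat k * coeff (coeff p j) i)"
    by (simp add: poly_eq_iff coeff_euler coeff_Const_mult flip: Const_of_nat)
  then show ?thesis
    by (auto simp: homogeneous_poly_def simp flip: of_nat_add)
qed

lemma homogeneous_poly_0 [simp]: "homogeneous_poly k 0"
  by (simp add: homogeneous_poly_def)

lemma homogeneous_poly_Const: "homogeneous_poly 0 (Const c :: 'k::field_char_0 bipoly)"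
  by (simp add: homogeneous_poly_iff_euler)

lemma homogeneous_poly_1: "homogeneous_poly 0 (1 :: 'k::field_char_0 bipoly)"
  using homogeneous_poly_Const[of 1] by simp

lemma homogeneous_poly_X1: "homogeneous_poly 1 (X1 :: 'k::field_char_0 bipoly)"
  by (simp add: homogeneous_poly_iff_euler) (simp add: euler_def)

lemma homogeneous_poly_X2: "homogeneous_poly 1 (X2 :: 'k::field_char_0 bipoly)"
  by (simp add: homogeneous_poly_iff_euler) (simp add: euler_def)

lemma homogeneous_poly_add:
  fixes p q :: "'k::field_char_0 bipoly"
  assumes "homogeneous_poly k p" "homogeneous_poly k q"
  shows "homogeneous_poly k (p + q)"
  using assms by (simp add: homogeneous_poly_iff_euler der_apply_add algebra_simps)

lemma homogeneous_poly_mult: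
  fixes p q :: "'k::field_char_0 bipoly"
  assumes "homogeneous_poly j p" "homogeneous_poly k q"
  shows "homogeneous_poly (j + k) (p * q)"
  using assms by (simp add: homogeneous_poly_iff_euler der_apply_mult algebra_simps)

lemma homogeneous_poly_Const_mult:
  fixes p :: "'k::field_char_0 bipoly"
  shows "homogeneous_poly k p \<Longrightarrow> homogeneous_poly k (Const c * p)"
  using homogeneous_poly_mult[OF homogeneous_poly_Const] by fastforce

lemma homogeneous_poly_uminus:
  fixes p :: "'k::field_char_0 bipoly"
  shows "homogeneous_poly k p \<Longrightarrow> homogeneous_poly k (- p)"
  by (simp add: homogeneous_poly_def)

lemma homogeneous_poly_diff:
  fixes p q :: "'k::field_char_0 bipoly"
  assumes "homogeneous_poly k p" "homogeneous_poly k q"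
  shows "homogeneous_poly k (p - q)"
  using homogeneous_poly_add[OF assms(1) homogeneous_poly_uminus[OF assms(2)]] by simp

lemma homogeneous_poly_power:
  fixes p :: "'k::field_char_0 bipoly"
  assumes "homogeneous_poly k p"
  shows "homogeneous_poly (n * k) (p ^ n)"
  by (induction n) (simp_all add: homogeneous_poly_1 homogeneous_poly_mult assms)

lemma homogeneous_poly_prod:
  fixes p :: "'i \<Rightarrow> 'k::field_char_0 bipoly"
  assumes "\<And>i. i \<in> A \<Longrightarrow> homogeneous_poly (k i) (p i)"
  shows "homogeneous_poly (\<Sum>i\<in>A. k i) (\<Prod>i\<in>A. p i)"
  using assms
  by (induction A rule: infinite_finite_induct)
    (simp_all add: homogeneous_poly_1 homogeneous_poly_mult)

lemma homogeneous_poly_partial1: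
  fixes p :: "'k::field_char_0 bipoly"
  assumes "homogeneous_poly k p"
  shows "homogeneous_poly (k - 1) (partial1 p)"
  unfolding homogeneous_poly_def
proof (intro allI impI)
  fix i j assume "coeff (coeff (partial1 p) j) i \<noteq> 0"
  then have "coeff (coeff p j) (Suc i) \<noteq> 0"
    by (auto simp: coeff_partial1 coeff_pderiv)
  then show "i + j = k - 1"
    using assms by (force simp: homogeneous_poly_def)
qed

lemma homogeneous_poly_partial2:
  fixes p :: "'k::field_char_0 bipoly"
  assumes "homogeneous_poly k p"
  shows "homogeneous_poly (k - 1) (partial2 p)"
  unfolding homogeneous_poly_def
proof (intro allI impI)
  fix i j assume "coeff (coeff (partial2 p) j) i \<noteq> 0"
  then have "coeff (coeff p (Suc j)) i \<noteq> 0"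
    by (auto simp: partial2_def coeff_pderiv of_nat_poly simp flip: of_nat_Suc)
  then show "i + j = k - 1"
    using assms by (force simp: homogeneous_poly_def)
qed

text \<open>The Leibniz rule for the Euler derivation shows that a cofactor of homogeneous polynomials
  is again an eigenvector, with the difference of the degrees as eigenvalue.  Reading this off
  from a nonzero coefficient also gives the inequality between the degrees.\<close>

lemma homogeneous_poly_cofactor:
  fixes p r :: "'k::field_char_0 bipoly"
  assumes p: "homogeneous_poly j p" and pr: "homogeneous_poly k (p * r)" and nz: "p * r \<noteq> 0"
  shows "j \<le> k \<and> homogeneous_poly (k - j) r"
proof -
  have "p * der_apply euler r + of_nat j * (p * r) = of_nat k * (p * r)"
    using p pr by (simp add: homogeneous_poly_iff_euler der_apply_mult algebra_simps)
  then have "p * (der_apply euler r + of_nat j * r) = p * (of_nat k * r)"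
    by (simp add: algebra_simps)
  then have "der_apply euler r + of_nat j * r = of_nat k * r"
    using nz by simp
  then have "coeff (coeff (der_apply euler r + Const (of_nat j) * r) t) i =
      coeff (coeff (Const (of_nat k) * r) t) i" for i t
    by (simp add: Const_of_nat)
  then have "(of_nat (i + t + j) :: 'k) * coeff (coeff r t) i = of_nat k * coeff (coeff r t) i" for i t
    by (simp add: coeff_euler coeff_Const_mult distrib_right)
  then have *: "i + t + j = k" if "coeff (coeff r t) i \<noteq> 0" for i t
    using that by (metis mult_right_cancel of_nat_eq_iff)
  moreover have "\<exists>i t. coeff (coeff r t) i \<noteq> 0"
    using nz by (metis coeff_0 mult_zero_right poly_eqI)
  ultimately show ?thesis
    by (fastforce simp: homogeneous_poly_def)
qed

lemma homogeneous_poly_dvd_imp_le: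
  fixes p q :: "'k::field_char_0 bipoly"
  assumes "homogeneous_poly j p" "homogeneous_poly k q" "p dvd q" "q \<noteq> 0"
  shows "j \<le> k"
  using assms homogeneous_poly_cofactor by (metis dvdE)

lemma homogeneous_poly_0_imp_Const:
  assumes "homogeneous_poly 0 p"
  shows "\<exists>c. p = Const c"
proof
  show "p = Const (coeff (coeff p 0) 0)"
  proof (intro poly_eqI)
    fix j i
    show "coeff (coeff p j) i = coeff (coeff (Const (coeff (coeff p 0) 0)) j) i"
      using assms by (auto simp: homogeneous_poly_def Const_def coeff_pCons split: nat.splits)
  qed
qed

section \<open>Proportionality of polynomials with parallel gradients\<close>

text \<open>If the Wronskian \<open>p q' - q p'\<close> vanishes, then so does its coefficient at
  \<open>degree p + degree q - 1\<close>, which is the product of the leading coefficients times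
  \<open>degree q - degree p\<close>.\<close>

lemma degree_eq_if_wronskian_0:
  fixes p q :: "'a::{idom, ring_char_0} poly"
  assumes W: "p * pderiv q = q * pderiv p" and "p \<noteq> 0" "q \<noteq> 0"
  shows "degree p = degree q"
proof -
  have lc: "coeff (r * pderiv s) (degree r + degree s - 1)
      = of_nat (degree s) * (lead_coeff r * lead_coeff s)"
    if "degree s > 0" for r s :: "'a poly"
  proof -
    have "coeff (r * pderiv s) (degree r + degree (pderiv s)) = lead_coeff r * lead_coeff (pderiv s)"
      by (rule coeff_mult_degree_sum)
    then show ?thesis
      using that by (simp add: degree_pderiv coeff_pderiv algebra_simps Suc_diff_Suc del: of_nat_Suc flip: of_nat_Suc)
  qed
  consider "degree p = 0" | "degree q = 0" | "degree p > 0" "degree q > 0" by blast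
  then show ?thesis
  proof cases
    case 1
    then have "pderiv p = 0" by (simp add: pderiv_eq_0_iff)
    then have "pderiv q = 0" using W assms by simp
    then show ?thesis using 1 by (simp add: pderiv_eq_0_iff)
  next
    case 2
    then have "pderiv q = 0" by (simp add: pderiv_eq_0_iff)
    then have "pderiv p = 0" using W assms by simp
    then show ?thesis using 2 by (simp add: pderiv_eq_0_iff)
  next
    case 3
    have "(of_nat (degree q) :: 'a) * (lead_coeff p * lead_coeff q)
        = of_nat (degree p) * (lead_coeff p * lead_coeff q)"
      using lc[OF 3(2), of p] lc[OF 3(1), of q] W by (simp add: ac_simps)
    then show ?thesis using assms by simp
  qed
qed

lemma proportional_if_wronskian_0:
  fixes p q :: "'a::{idom, ring_char_0} poly"
  assumes W: "p * pderiv q = q * pderiv p" and "p \<noteq> 0" "q \<noteq> 0"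
  shows "smult (lead_coeff q) p = smult (lead_coeff p) q"
proof (rule ccontr)
  assume ne: "\<not> ?thesis"
  \<comment> \<open>The Wronskian of \<open>r\<close> and \<open>q\<close> vanishes too, but \<open>r\<close> has no term in the degree of \<open>q\<close>.\<close>
  define r where "r = smult (lead_coeff q) p - smult (lead_coeff p) q"
  have r: "r \<noteq> 0"
    using ne by (simp add: r_def)
  have pq: "degree p = degree q"
    by (rule degree_eq_if_wronskian_0) (use assms in auto)
  have "r * pderiv q = q * pderiv r"
    using W by (simp add: r_def pderiv_diff pderiv_smult algebra_simps)
  then have rq: "degree r = degree q"
    using r assms by (intro degree_eq_if_wronskian_0) auto
  then have "lead_coeff r = 0"
    by (simp add: r_def pq)
  with r show False by simp
qed

text \<open>Two homogeneous polynomials of the same positive degree whose Jacobian determinant vanishes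
  are proportional over the field.  Euler's identity turns the vanishing Jacobian into a vanishing
  Wronskian with respect to \<open>x\<^sub>2\<close>, so the two polynomials are proportional up to their leading
  coefficients in \<open>x\<^sub>2\<close>; by homogeneity, these are multiples of one power of \<open>x\<^sub>1\<close>, which
  cancels.\<close>

lemma homogeneous_linearly_dependent:
  fixes p q :: "'k::field_char_0 bipoly"
  assumes hom: "homogeneous_poly k p" "homogeneous_poly k q" and "k > 0"
    and J: "partial1 p * partial2 q = partial2 p * partial1 q"
  shows "\<exists>x y g. (x \<noteq> 0 \<or> y \<noteq> 0) \<and> p = Const x * g \<and> q = Const y * g"
proof (cases "p = 0 \<or> q = 0")
  case True
  then show ?thesis
    by (metis Const_0 Const_1 mult_1 mult_zero_left zero_neq_one)
next
  case False
  have E: "X1 * partial1 r + X2 * partial2 r = of_nat k * r" if "homogeneous_poly k r" for r :: "'k bipoly"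
    using that by (simp add: homogeneous_poly_iff_euler der_apply_def euler_def)
  have "of_nat k * (p * partial2 q) = (X1 * partial1 p + X2 * partial2 p) * partial2 q"
    by (simp add: E hom)
  also have "\<dots> = (X1 * partial1 q + X2 * partial2 q) * partial2 p"
    using J by (simp add: algebra_simps)
  also have "\<dots> = of_nat k * (q * partial2 p)"
    by (simp add: E hom)
  finally have "p * pderiv q = q * pderiv p"
    using \<open>k > 0\<close> by (simp add: partial2_def)
  note W = this
  define N where "N = degree q"
  have N: "degree p = N"
    unfolding N_def by (rule degree_eq_if_wronskian_0) (use W False in auto)
  have mon: "\<exists>c. c \<noteq> 0 \<and> lead_coeff r = monom c (k - N)"
    if "homogeneous_poly k r" "r \<noteq> 0" "degree r = N" for r :: "'k bipoly"
  proof (intro exI conjI)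
    have z: "coeff (lead_coeff r) i = 0" if "i \<noteq> k - N" for i
      using that \<open>homogeneous_poly k r\<close> \<open>degree r = N\<close> by (force simp: homogeneous_poly_def)
    show eq: "lead_coeff r = monom (coeff (lead_coeff r) (k - N)) (k - N)"
      using z by (intro poly_eqI) auto
    show "coeff (lead_coeff r) (k - N) \<noteq> 0"
      using eq \<open>r \<noteq> 0\<close> by (metis leading_coeff_0_iff monom_0 monom_eq_0_iff)
  qed
  obtain x where x: "x \<noteq> 0" "lead_coeff p = monom x (k - N)"
    using mon[of p] hom False N by auto
  obtain y where y: "y \<noteq> 0" "lead_coeff q = monom y (k - N)"
    using mon[of q] hom False N_def by auto
  have sm: "smult (monom c (k - N)) r = [:monom 1 (k - N):] * (Const c * r)" for c and r :: "'k bipoly"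
    by (simp add: Const_def smult_monom)
  have "smult (monom y (k - N)) p = smult (monom x (k - N)) q"
    using proportional_if_wronskian_0[OF W] False x y by simp
  then have "Const y * p = Const x * q"
    unfolding sm by (subst (asm) mult_left_cancel) (simp_all add: monom_eq_0_iff)
  then have "Const (inverse x) * (Const y * p) = Const (inverse x * x) * q"
    by (simp add: Const_mult mult.assoc)
  moreover define g where "g = Const (inverse x) * p"
  ultimately have "q = Const y * g"
    using x by (simp add: mult.left_commute)
  moreover have "p = Const x * g"
    using x by (simp add: g_def mult.assoc [symmetric] flip: Const_mult)
  ultimately show ?thesis
    using x by metis
qed

section \<open>Linear forms are prime\<close>

text \<open>The linear form \<open>a x\<^sub>1 + b x\<^sub>2\<close>.\<close>

definition lin :: "'k::field \<Rightarrow> 'k \<Rightarrow> 'k bipoly" where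
  "lin a b = Const a * X1 + Const b * X2"

lemma der_apply_lin: "der_apply \<phi> (lin a b) = Const a * fst \<phi> + Const b * snd \<phi>"
  by (simp add: lin_def der_apply_add der_apply_Const_mult)

lemma homogeneous_poly_lin: "homogeneous_poly 1 (lin a b :: 'k::field_char_0 bipoly)"
  unfolding lin_def
  by (intro homogeneous_poly_add homogeneous_poly_Const_mult homogeneous_poly_X1 homogeneous_poly_X2)

lemma prime_elem_monic_linear:
  fixes c :: "'a::idom"
  shows "prime_elem [:- c, 1:]"
proof (rule prime_elemI)
  show "\<not> [:- c, 1:] dvd 1"
    by (simp add: is_unit_poly_iff)
qed (simp_all flip: poly_eq_0_iff_dvd)

lemma prime_elem_lin:
  assumes "a \<noteq> 0 \<or> b \<noteq> 0"
  shows "prime_elem (lin a b)"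
proof (cases "b = 0")
  case True
  have "prime_elem [:[:- 0, 1:] :: 'a poly:]"
    by (intro lift_prime_elem_poly prime_elem_monic_linear)
  then have "prime_elem (Const a * X1)"
    using assms True by (simp add: prime_elem_mult_unit_left X1_def del: mult_pCons_right)
  then show ?thesis using True by (simp add: lin_def)
next
  case False
  have "lin a b = Const b * [:- [:0, - (a / b):], 1:]"
    using False by (simp add: lin_def Const_def X1_def X2_def)
  then show ?thesis
    using False prime_elem_monic_linear[of "[:0, - (a / b):]"]
    by (simp only: prime_elem_mult_unit_left Const_dvd_1 not_False_eq_True)
qed

lemma lin_dvd_lin_imp:
  assumes "lin a b dvd lin a' b'"
  shows "a * b' = a' * b"
proof -
  \<comment> \<open>Evaluation at the zero \<open>(b, -a)\<close> of the dividing form.\<close>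
  have eval: "poly (poly (lin x y) [:- a:]) b = x * b - y * a" for x y
    by (simp add: lin_def Const_def X1_def X2_def)
  obtain r where r: "lin a' b' = lin a b * r"
    using assms by (rule dvdE)
  have "poly (poly (lin a' b') [:- a:]) b = 0"
    unfolding r by (simp add: eval)
  then show ?thesis by (simp add: eval algebra_simps)
qed

lemma prime_elem_dvd_prodE:
  fixes f :: "'i \<Rightarrow> 'a::algebraic_semidom"
  assumes "prime_elem p" "p dvd (\<Prod>i\<in>A. f i)"
  obtains i where "i \<in> A" "p dvd f i"
proof -
  have "\<exists>i\<in>A. p dvd f i"
    using assms(2)
    by (induction A rule: infinite_finite_induct)
      (use assms(1) in \<open>auto simp: prime_elem_dvd_mult_iff prime_elem_not_unit\<close>)
  then show ?thesis using that by blast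
qed

lemma prime_elem_power_dvd_mult_imp:
  fixes p :: "'a::algebraic_semidom"
  assumes "prime_elem p" "p ^ n dvd x * y" "\<not> p dvd x"
  shows "p ^ n dvd y"
  using prime_power_dvd_multD[of p n x y] assms by (cases "n = 0") simp_all

lemma is_unit_if_dvd_prod_primes:
  fixes f :: "'i \<Rightarrow> 'a::algebraic_semidom"
  assumes "g * h = (\<Prod>i\<in>A. f i ^ n i)"
    and "\<And>i. i \<in> A \<Longrightarrow> prime_elem (f i)" "\<And>i. i \<in> A \<Longrightarrow> \<not> f i dvd g"
  shows "g dvd 1"
  using assms
proof (induction A arbitrary: h rule: infinite_finite_induct)
  case (insert i A)
  have p: "prime_elem (f i)" "\<not> f i dvd g"
    using insert.prems by auto
  have "f i ^ n i dvd g * h"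
    using insert.prems(1) insert.hyps by simp
  then have "f i ^ n i dvd h"
    by (rule prime_elem_power_dvd_mult_imp[OF p(1) _ p(2)])
  then obtain h' where h': "h = f i ^ n i * h'"
    by (rule dvdE)
  have "f i ^ n i * (g * h') = f i ^ n i * (\<Prod>j\<in>A. f j ^ n j)"
    using insert.prems(1) insert.hyps by (simp add: h' mult.left_commute)
  then have "g * h' = (\<Prod>j\<in>A. f j ^ n j)"
    using p(1) by (simp add: prime_elem_not_zeroI)
  then show ?case
    using insert.IH insert.prems by blast
qed (auto intro: dvdI[OF sym])

section \<open>Saito's criterion for lines in the plane\<close>

text \<open>The determinant of the coefficients of two derivations.\<close>

definition der_det :: "'k::field der \<Rightarrow> 'k der \<Rightarrow> 'k bipoly" where
  "der_det \<theta> \<eta> = fst \<theta> * snd \<eta> - snd \<theta> * fst \<eta>"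

text \<open>A finite family of pairwise distinct lines through the origin, the line with index \<open>i\<close>
  having the equation \<open>a i x\<^sub>1 + b i x\<^sub>2 = 0\<close>.\<close>

locale line_family =
  fixes I :: "'i set" and a b :: "'i \<Rightarrow> 'k::field_char_0"
  assumes finite_I [simp]: "finite I"
    and nonzero: "i \<in> I \<Longrightarrow> a i \<noteq> 0 \<or> b i \<noteq> 0"
    and nonparallel: "i \<in> I \<Longrightarrow> j \<in> I \<Longrightarrow> i \<noteq> j \<Longrightarrow> a i * b j \<noteq> a j * b i"
begin

text \<open>The linear form that vanishes on the line \<open>i\<close>.\<close>

definition L :: "'i \<Rightarrow> 'k bipoly" where
  "L i = lin (a i) (b i)"

text \<open>The module of logarithmic derivations with multiplicity \<open>m\<close>.\<close>

definition D :: "('i \<Rightarrow> nat) \<Rightarrow> 'k der set" where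
  "D m = {\<theta>. \<forall>i\<in>I. L i ^ m i dvd der_apply \<theta> (L i)}"

lemma D_I: "(\<And>i. i \<in> I \<Longrightarrow> L i ^ m i dvd der_apply \<theta> (L i)) \<Longrightarrow> \<theta> \<in> D m"
  by (simp add: D_def)

lemma D_D: "\<theta> \<in> D m \<Longrightarrow> i \<in> I \<Longrightarrow> L i ^ m i dvd der_apply \<theta> (L i)"
  by (simp add: D_def)

text \<open>The defining polynomial of the family of lines with multiplicity \<open>m\<close>.\<close>

definition Q :: "('i \<Rightarrow> nat) \<Rightarrow> 'k bipoly" where
  "Q m = (\<Prod>i\<in>I. L i ^ m i)"

lemma prime_L: "i \<in> I \<Longrightarrow> prime_elem (L i)"
  unfolding L_def by (intro prime_elem_lin nonzero)

lemma L_nonzero: "i \<in> I \<Longrightarrow> L i \<noteq> 0"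
  using prime_L by (metis prime_elem_not_zeroI)

lemma not_L_dvd_prod:
  assumes "i \<in> I" "A \<subseteq> I - {i}"
  shows "\<not> L i dvd (\<Prod>j\<in>A. L j ^ m j)"
proof
  assume "L i dvd (\<Prod>j\<in>A. L j ^ m j)"
  then obtain j where j: "j \<in> A" "L i dvd L j ^ m j"
    by (rule prime_elem_dvd_prodE[OF prime_L[OF assms(1)]])
  then have "L i dvd L j"
    using prime_L[OF assms(1)] by (metis prime_elem_dvd_power)
  then show False
    using nonparallel[of i j] assms j by (auto simp: L_def dest!: lin_dvd_lin_imp)
qed

lemma prod_L_dvd:
  assumes "A \<subseteq> I" "\<And>i. i \<in> A \<Longrightarrow> L i ^ m i dvd p"
  shows "(\<Prod>i\<in>A. L i ^ m i) dvd p"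
proof -
  have "finite A"
    using assms(1) finite_I by (rule finite_subset)
  then show ?thesis
    using assms
  proof (induction A)
    case (insert i A)
    then obtain r where r: "p = (\<Prod>j\<in>A. L j ^ m j) * r"
      by (metis dvdE insert_iff insert_subset)
    have nd: "\<not> L i dvd (\<Prod>j\<in>A. L j ^ m j)"
      by (rule not_L_dvd_prod) (use insert in auto)
    have prime: "prime_elem (L i)"
      using insert.prems by (intro prime_L) simp
    have "L i ^ m i dvd (\<Prod>j\<in>A. L j ^ m j) * r"
      using insert.prems r by simp
    then have "L i ^ m i dvd r"
      by (rule prime_elem_power_dvd_mult_imp[OF prime _ nd])
    then show ?case
      using insert.hyps by (simp add: r mult.commute mult_dvd_mono)
  qed simp
qed

lemma Q_nonzero: "Q m \<noteq> 0"
  by (simp add: Q_def L_nonzero)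

lemma homogeneous_poly_prod_L: "homogeneous_poly (\<Sum>i\<in>A. m i) (\<Prod>i\<in>A. L i ^ m i)"
  using homogeneous_poly_power[OF homogeneous_poly_lin]
  by (intro homogeneous_poly_prod) (force simp: L_def)

lemma homogeneous_poly_Q: "homogeneous_poly (\<Sum>i\<in>I. m i) (Q m)"
  unfolding Q_def by (rule homogeneous_poly_prod_L)

text \<open>By Cramer's rule, a multiple of the determinant by a coefficient of \<open>L i\<close> is a combination
  of the values of the two derivations on \<open>L i\<close> with polynomial coefficients.\<close>

lemma Q_dvd_der_det:
  assumes "\<theta> \<in> D m" "\<eta> \<in> D m"
  shows "Q m dvd der_det \<theta> \<eta>"
  unfolding Q_def
proof (rule prod_L_dvd)
  fix i assume i: "i \<in> I"
  have *: "L i ^ m i dvd der_apply \<theta> (L i)" "L i ^ m i dvd der_apply \<eta> (L i)"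
    using assms i by (auto dest: D_D)
  have "Const (a i) * der_det \<theta> \<eta> = der_apply \<theta> (L i) * snd \<eta> - snd \<theta> * der_apply \<eta> (L i)"
    and "Const (b i) * der_det \<theta> \<eta> = fst \<theta> * der_apply \<eta> (L i) - der_apply \<theta> (L i) * fst \<eta>"
    by (simp_all add: L_def der_apply_lin der_det_def algebra_simps)
  then have "L i ^ m i dvd Const (a i) * der_det \<theta> \<eta>" "L i ^ m i dvd Const (b i) * der_det \<theta> \<eta>"
    using * by (metis dvd_diff dvd_mult dvd_mult2)+
  then show "L i ^ m i dvd der_det \<theta> \<eta>"
    using nonzero[OF i] by (auto simp: dvd_Const_mult_iff)
qed simp

text \<open>The part of the defining polynomial that comes from the lines other than \<open>i\<close>.\<close>

definition R :: "('i \<Rightarrow> nat) \<Rightarrow> 'i \<Rightarrow> 'k bipoly" where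
  "R m i = (\<Prod>j\<in>I - {i}. L j ^ m j)"

text \<open>The constant vector field along the line \<open>i\<close>, which kills \<open>L i\<close>, times \<open>R m i\<close>.  The factor
  makes it logarithmic along the other lines.\<close>

definition tangent :: "('i \<Rightarrow> nat) \<Rightarrow> 'i \<Rightarrow> 'k der" where
  "tangent m i = (R m i * Const (b i), - (R m i * Const (a i)))"

lemma der_apply_tangent:
  "der_apply (tangent m i) (L j) = R m i * Const (a j * b i - a i * b j)"
  by (simp add: tangent_def L_def der_apply_lin Const_diff Const_mult algebra_simps)

lemma tangent_in_D: "i \<in> I \<Longrightarrow> tangent m i \<in> D m"
proof (rule D_I)
  fix j assume "j \<in> I"
  show "L j ^ m j dvd der_apply (tangent m i) (L j)"
  proof (cases "j = i")
    case False
    then have "L j ^ m j dvd R m i"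
      unfolding R_def using \<open>j \<in> I\<close> by (intro dvd_prodI) auto
    then show ?thesis
      by (simp add: der_apply_tangent)
  qed (simp add: der_apply_tangent)
qed

lemma Q_scale_in_D: "der_scale (Q m) \<theta> \<in> D m"
proof (rule D_I)
  fix i assume "i \<in> I"
  then have "L i ^ m i dvd Q m"
    unfolding Q_def by (intro dvd_prodI) auto
  then show "L i ^ m i dvd der_apply (der_scale (Q m) \<theta>) (L i)"
    by (simp add: der_apply_der_scale)
qed

text \<open>One direction of Saito's criterion: generators have the determinant \<open>Q m\<close> up to a unit.
  The determinant of the generators divides that of any two logarithmic derivations.  Applied to
  \<open>tangent m i\<close> and to a multiple of a coordinate derivation by \<open>Q m\<close>, this shows that the cofactor
  \<open>g\<close> of \<open>Q m\<close> divides \<open>R m i\<close> for every \<open>i\<close>.  These polynomials have no common prime factor.\<close>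

lemma der_det_generators:
  assumes gen: "\<And>\<xi>. \<xi> \<in> D m \<Longrightarrow> \<exists>s t. \<xi> = der_scale s \<eta>1 + der_scale t \<eta>2"
    and \<eta>: "\<eta>1 \<in> D m" "\<eta>2 \<in> D m" and "I \<noteq> {}"
  shows "\<exists>u. u dvd 1 \<and> der_det \<eta>1 \<eta>2 = Q m * u"
proof -
  obtain g where g: "der_det \<eta>1 \<eta>2 = Q m * g"
    using Q_dvd_der_det[OF \<eta>] by (rule dvdE)
  have dvd: "der_det \<eta>1 \<eta>2 dvd der_det \<xi> \<zeta>" if xz: "\<xi> \<in> D m" "\<zeta> \<in> D m" for \<xi> \<zeta>
  proof -
    obtain s t where st: "\<xi> = der_scale s \<eta>1 + der_scale t \<eta>2"
      using gen[OF xz(1)] by blast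
    obtain s' t' where st': "\<zeta> = der_scale s' \<eta>1 + der_scale t' \<eta>2"
      using gen[OF xz(2)] by blast
    have "der_det \<xi> \<zeta> = der_det \<eta>1 \<eta>2 * (s * t' - t * s')"
      by (simp add: st st' der_det_def der_scale_def algebra_simps)
    then show ?thesis by simp
  qed
  have g_dvd: "g dvd R m i" if i: "i \<in> I" for i
  proof -
    have "der_det (tangent m i) (der_scale (Q m) (0, 1)) = Q m * (Const (b i) * R m i)"
      "der_det (tangent m i) (der_scale (Q m) (1, 0)) = Q m * (Const (a i) * R m i)"
      by (simp_all add: der_det_def tangent_def der_scale_def)
    then have "Q m * g dvd Q m * (Const (b i) * R m i)" "Q m * g dvd Q m * (Const (a i) * R m i)"
      using dvd[OF tangent_in_D Q_scale_in_D, OF i] by (metis g)+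
    then show ?thesis
      using nonzero[OF i] by (auto simp: Q_nonzero dvd_Const_mult_iff)
  qed
  have "g dvd 1"
  proof (rule ccontr)
    assume "\<not> g dvd 1"
    obtain i where i: "i \<in> I" using \<open>I \<noteq> {}\<close> by blast
    obtain h where "g * h = (\<Prod>j\<in>I - {i}. L j ^ m j)"
      using g_dvd[OF i] unfolding R_def by (metis dvdE)
    then obtain j where j: "j \<in> I" "L j dvd g"
      using is_unit_if_dvd_prod_primes[of g h L m "I - {i}"] \<open>\<not> g dvd 1\<close> prime_L by blast
    then have "L j dvd R m j"
      using g_dvd dvd_trans by blast
    then show False
      using not_L_dvd_prod[OF j(1), of "I - {j}" m] by (simp add: R_def)
  qed
  then show ?thesis using g by blast
qed

text \<open>The other direction of Saito's criterion, generation here and independence in the next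
  lemma, is Cramer's rule.\<close>

lemma basis_if_der_det:
  assumes det: "der_det \<eta>1 \<eta>2 = Const c * Q m" and "c \<noteq> 0"
    and \<eta>: "\<eta>1 \<in> D m" "\<eta>2 \<in> D m" and \<xi>: "\<xi> \<in> D m"
  shows "\<exists>s t. \<xi> = der_scale s \<eta>1 + der_scale t \<eta>2"
proof -
  obtain s where s: "der_det \<xi> \<eta>2 = Q m * s"
    using Q_dvd_der_det[OF \<xi> \<eta>(2)] by (rule dvdE)
  obtain t where t: "der_det \<eta>1 \<xi> = Q m * t"
    using Q_dvd_der_det[OF \<eta>(1) \<xi>] by (rule dvdE)
  have cramer: "der_scale (der_det \<eta>1 \<eta>2) \<xi> =
      der_scale (der_det \<xi> \<eta>2) \<eta>1 + der_scale (der_det \<eta>1 \<xi>) \<eta>2"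
    by (simp add: der_scale_def der_det_def prod_eq_iff algebra_simps)
  have "der_scale (Q m) (der_scale (Const c) \<xi>) = der_scale (Q m) (der_scale s \<eta>1 + der_scale t \<eta>2)"
    using cramer by (simp add: det s t der_scale_def prod_eq_iff algebra_simps)
  then have "der_scale (Const c) \<xi> = der_scale s \<eta>1 + der_scale t \<eta>2"
    by (simp add: der_scale_def prod_eq_iff Q_nonzero)
  then have "der_scale (Const (inverse c)) (der_scale (Const c) \<xi>) =
      der_scale (Const (inverse c) * s) \<eta>1 + der_scale (Const (inverse c) * t) \<eta>2"
    by (simp add: der.scale_right_distrib)
  moreover have "der_scale (Const (inverse c)) (der_scale (Const c) \<xi>) = \<xi>"
    using \<open>c \<noteq> 0\<close> by (simp flip: Const_mult)
  ultimately show ?thesis by metis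
qed

lemma independent_if_der_det:
  assumes "der_det \<eta>1 \<eta>2 \<noteq> 0" and st: "der_scale s \<eta>1 + der_scale t \<eta>2 = 0"
  shows "s = 0 \<and> t = 0"
proof -
  have "s * der_det \<eta>1 \<eta>2 = der_det (der_scale s \<eta>1 + der_scale t \<eta>2) \<eta>2"
    "t * der_det \<eta>1 \<eta>2 = der_det \<eta>1 (der_scale s \<eta>1 + der_scale t \<eta>2)"
    by (simp_all add: der_det_def der_scale_def algebra_simps)
  then have "s * der_det \<eta>1 \<eta>2 = 0" "t * der_det \<eta>1 \<eta>2 = 0"
    unfolding st by (simp_all add: der_det_def)
  then show ?thesis using assms(1) by simp
qed

lemma D_add: "\<xi> \<in> D m \<Longrightarrow> \<zeta> \<in> D m \<Longrightarrow> \<xi> + \<zeta> \<in> D m"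
  by (simp add: D_def der_apply_plus)

lemma D_scale: "\<xi> \<in> D m \<Longrightarrow> der_scale s \<xi> \<in> D m"
  by (simp add: D_def der_apply_der_scale)

end

section \<open>Universal derivations of a family of lines\<close>

lemma nabla_conv_der_scale:
  "nabla \<phi> \<theta> = der_scale (fst \<phi>) (nabla (1, 0) \<theta>) + der_scale (snd \<phi>) (nabla (0, 1) \<theta>)"
  by (simp add: nabla_def der_scale_def der_apply_def)

lemma module_hom_nabla: "module_hom der_scale der_scale (\<lambda>\<phi>. nabla \<phi> \<theta>)"
  by unfold_locales (simp_all add: nabla_def der_scale_def der_apply_def algebra_simps)

lemma der_apply_nabla_lin: "der_apply (nabla \<phi> \<theta>) (lin x y) = der_apply \<phi> (der_apply \<theta> (lin x y))"
  by (simp add: der_apply_lin nabla_def der_apply_add der_apply_Const_mult)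

text \<open>The Jacobian determinant of the two coefficients of a derivation.\<close>

definition jacobian :: "'k::field der \<Rightarrow> 'k bipoly" where
  "jacobian \<theta> = der_det (nabla (1, 0) \<theta>) (nabla (0, 1) \<theta>)"

lemma jacobian_eq:
  "jacobian \<theta> = partial1 (fst \<theta>) * partial2 (snd \<theta>) - partial1 (snd \<theta>) * partial2 (fst \<theta>)"
  by (simp add: jacobian_def der_det_def nabla_def der_apply_def)

lemma der_det_nabla: "der_det (nabla \<phi> \<theta>) (nabla \<psi> \<theta>) = der_det \<phi> \<psi> * jacobian \<theta>"
  unfolding jacobian_def
  by (subst (1 2) nabla_conv_der_scale) (simp add: der_det_def der_scale_def algebra_simps)

text \<open>Both coefficients are homogeneous of degree \<open>k\<close>; the zero derivation is included.\<close>

definition homogeneous_pair :: "nat \<Rightarrow> 'k::field der \<Rightarrow> bool" where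
  "homogeneous_pair k \<theta> \<longleftrightarrow> homogeneous_poly k (fst \<theta>) \<and> homogeneous_poly k (snd \<theta>)"

lemma homogeneous_pair_nabla:
  fixes \<theta> :: "'k::field_char_0 der"
  assumes "homogeneous_pair j \<phi>" "homogeneous_pair k \<theta>"
  shows "homogeneous_pair (j + (k - 1)) (nabla \<phi> \<theta>)"
  using assms unfolding homogeneous_pair_def nabla_def der_apply_def fst_conv snd_conv
  by (blast intro: homogeneous_poly_add homogeneous_poly_mult homogeneous_poly_partial1
      homogeneous_poly_partial2)

lemma homogeneous_poly_der_det:
  fixes \<theta> :: "'k::field_char_0 der"
  assumes "homogeneous_pair j \<theta>" "homogeneous_pair k \<eta>"
  shows "homogeneous_poly (j + k) (der_det \<theta> \<eta>)"
  using assms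
  by (simp add: homogeneous_pair_def der_det_def homogeneous_poly_diff homogeneous_poly_mult)

lemma homogeneous_poly_jacobian:
  fixes \<theta> :: "'k::field_char_0 der"
  assumes "homogeneous_pair k \<theta>"
  shows "homogeneous_poly ((k - 1) + (k - 1)) (jacobian \<theta>)"
proof -
  have "homogeneous_pair 0 ((1, 0) :: 'k der)" "homogeneous_pair 0 ((0, 1) :: 'k der)"
    by (simp_all add: homogeneous_pair_def homogeneous_poly_1)
  from this[THEN homogeneous_pair_nabla, OF assms] show ?thesis
    unfolding jacobian_def using homogeneous_poly_der_det by fastforce
qed

lemma nabla_euler:
  fixes \<theta> :: "'k::field_char_0 der"
  assumes "homogeneous_pair k \<theta>"
  shows "nabla euler \<theta> = der_scale (of_nat k) \<theta>"
  using assms by (simp add: homogeneous_pair_def homogeneous_poly_iff_euler nabla_def der_scale_def)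

lemma degree_pos_if_jacobian_nonzero:
  assumes "homogeneous_pair k \<theta>" "jacobian \<theta> \<noteq> 0"
  shows "k > 0"
proof (rule ccontr)
  assume "\<not> k > 0"
  then obtain c c' where "fst \<theta> = Const c" "snd \<theta> = Const c'"
    using assms homogeneous_poly_0_imp_Const unfolding homogeneous_pair_def by (metis gr0I)
  then have "jacobian \<theta> = 0"
    by (simp add: jacobian_eq Const_def partial1_def map_poly_pCons)
  with assms show False by simp
qed

context line_family
begin

lemma nabla_in_D:
  assumes "\<theta> \<in> D (\<lambda>i. m i + 1)"
  shows "nabla \<phi> \<theta> \<in> D m"
proof (rule D_I)
  fix i assume "i \<in> I"
  then have "L i ^ Suc (m i) dvd der_apply \<theta> (L i)"
    using D_D[OF assms] by simp
  then show "L i ^ m i dvd der_apply (nabla \<phi> \<theta>) (L i)"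
    unfolding L_def der_apply_nabla_lin by (rule power_dvd_der_apply)
qed

lemma nabla_in_D_log:
  assumes "\<phi> \<in> D (\<lambda>_. 1)" "\<theta> \<in> D m"
  shows "nabla \<phi> \<theta> \<in> D m"
proof (rule D_I)
  fix i assume i: "i \<in> I"
  have "L i ^ m i dvd der_apply \<theta> (L i)" "L i dvd der_apply \<phi> (L i)"
    using D_D[OF assms(2) i] D_D[OF assms(1) i] by simp_all
  then show "L i ^ m i dvd der_apply (nabla \<phi> \<theta>) (L i)"
    unfolding L_def der_apply_nabla_lin by (rule power_dvd_der_apply_log)
qed

text \<open>The gradient of the reduced defining polynomial, rotated by a right angle.  Together with the
  Euler derivation it is, for a nonempty family of lines, a basis of the logarithmic derivations
  of multiplicity one.\<close>

definition gradient_perp :: "'k der" where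
  "gradient_perp = (partial2 (Q (\<lambda>_. 1)), - partial1 (Q (\<lambda>_. 1)))"

lemma gradient_perp_in_D: "gradient_perp \<in> D (\<lambda>_. 1)"
proof (rule D_I)
  fix i assume i: "i \<in> I"
  define S where "S = (\<Prod>j\<in>I - {i}. L j)"
  have Q: "Q (\<lambda>_. 1) = L i * S"
    using i by (simp add: Q_def S_def prod.remove)
  have *: "der_apply gradient_perp p = partial1 p * partial2 (L i * S) - partial2 p * partial1 (L i * S)" for p
    unfolding gradient_perp_def der_apply_def Q by (simp add: mult.commute)
  show "L i ^ 1 dvd der_apply gradient_perp (L i)"
    unfolding * by (simp add: partial1_mult partial2_mult algebra_simps)
qed

lemma der_det_euler_gradient_perp:
  "der_det euler gradient_perp = - (of_nat (card I) * Q (\<lambda>_. 1))"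
proof -
  have "der_det euler gradient_perp = - der_apply euler (Q (\<lambda>_. 1))"
    by (simp add: der_det_def euler_def gradient_perp_def der_apply_def)
  then show ?thesis
    using homogeneous_poly_Q[of "\<lambda>_. 1"] by (simp add: homogeneous_poly_iff_euler)
qed

lemma homogeneous_pair_gradient_perp: "homogeneous_pair (card I - 1) gradient_perp"
  using homogeneous_poly_partial1[OF homogeneous_poly_Q[of "\<lambda>_. 1"]]
    homogeneous_poly_partial2[OF homogeneous_poly_Q[of "\<lambda>_. 1"]]
  by (simp add: homogeneous_pair_def gradient_perp_def homogeneous_poly_uminus)

lemma Q_Suc: "Q (\<lambda>i. m i + 1) = Q (\<lambda>_. 1) * Q m"
  by (simp add: Q_def prod.distrib)

lemma degree_sum_if_generators:
  assumes "\<And>\<xi>. \<xi> \<in> D m \<Longrightarrow> \<exists>s t. \<xi> = der_scale s \<eta>1 + der_scale t \<eta>2"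
    and "\<eta>1 \<in> D m" "\<eta>2 \<in> D m" "I \<noteq> {}"
    and hom: "homogeneous_poly k (der_det \<eta>1 \<eta>2)"
  shows "der_det \<eta>1 \<eta>2 \<noteq> 0" and "k = (\<Sum>i\<in>I. m i)"
proof -
  obtain u where u: "u dvd 1" "der_det \<eta>1 \<eta>2 = Q m * u"
    using der_det_generators[OF assms(1-4)] by blast
  then show nz: "der_det \<eta>1 \<eta>2 \<noteq> 0"
    using Q_nonzero by auto
  have "der_det \<eta>1 \<eta>2 dvd Q m"
    using u by (simp add: mult_unit_dvd_iff)
  then have "k \<le> (\<Sum>i\<in>I. m i)"
    by (rule homogeneous_poly_dvd_imp_le[OF hom homogeneous_poly_Q _ Q_nonzero])
  moreover have "(\<Sum>i\<in>I. m i) \<le> k"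
    by (rule homogeneous_poly_dvd_imp_le[OF homogeneous_poly_Q hom _ nz]) (simp add: u)
  ultimately show "k = (\<Sum>i\<in>I. m i)" by simp
qed

text \<open>If the Jacobian of \<open>\<theta>\<close> vanishes, then \<open>\<theta>\<close> is a polynomial multiple \<open>g\<close> of a constant
  vector field \<open>(x, y)\<close>.  That vector field is tangent to at most one of the lines, so \<open>g\<close> is
  divisible by the powers of the linear forms of all the other lines.\<close>

lemma jacobian_nonzero_if_large_multiplicities:
  assumes \<theta>: "\<theta> \<in> D m" "homogeneous_pair k \<theta>" "\<theta> \<noteq> 0" and "k > 0"
    and large: "\<And>i. i \<in> I \<Longrightarrow> (\<Sum>j\<in>I - {i}. m j) > k" and "I \<noteq> {}"
  shows "jacobian \<theta> \<noteq> 0"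
proof
  assume "jacobian \<theta> = 0"
  then obtain x y g where xy: "x \<noteq> 0 \<or> y \<noteq> 0" and g: "fst \<theta> = Const x * g" "snd \<theta> = Const y * g"
    using homogeneous_linearly_dependent[of k "fst \<theta>" "snd \<theta>"] assms(2,4)
    by (auto simp: jacobian_eq homogeneous_pair_def mult.commute)
  have "g \<noteq> 0"
    using \<open>\<theta> \<noteq> 0\<close> g by (auto simp: prod_eq_iff)
  have "homogeneous_poly k g"
  proof -
    have "\<exists>c p. c \<noteq> 0 \<and> homogeneous_poly k p \<and> p = Const c * g"
      using xy g \<theta>(2) unfolding homogeneous_pair_def by metis
    then obtain c p where c: "c \<noteq> 0" "homogeneous_poly k p" "p = Const c * g" by blast
    then show ?thesis
      using homogeneous_poly_cofactor[OF homogeneous_poly_Const, of k c g] \<open>g \<noteq> 0\<close> by simp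
  qed
  have dvd: "L i ^ m i dvd g" if i: "i \<in> I" and ne: "a i * x + b i * y \<noteq> 0" for i
  proof -
    have "der_apply \<theta> (L i) = Const (a i * x + b i * y) * g"
      by (simp add: L_def der_apply_lin g Const_add Const_mult algebra_simps)
    then show ?thesis
      using D_D[OF \<theta>(1) i] ne by (simp add: dvd_Const_mult_iff)
  qed
  have "\<exists>i\<in>I. \<forall>j\<in>I - {i}. a j * x + b j * y \<noteq> 0"
  proof (cases "\<exists>i\<in>I. a i * x + b i * y = 0")
    case True
    then obtain i where i: "i \<in> I" "a i * x + b i * y = 0" by blast
    have "a j * x + b j * y \<noteq> 0" if "j \<in> I - {i}" for j
    proof
      assume j: "a j * x + b j * y = 0"
      have "(a i * b j - a j * b i) * x = b j * (a i * x + b i * y) - b i * (a j * x + b j * y)"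
        "(a i * b j - a j * b i) * y = a i * (a j * x + b j * y) - a j * (a i * x + b i * y)"
        by (simp_all add: algebra_simps)
      then show False
        using nonparallel[of i j] that i j xy by auto
    qed
    then show ?thesis using i by blast
  qed (use \<open>I \<noteq> {}\<close> in blast)
  then obtain i where i: "i \<in> I" "\<And>j. j \<in> I - {i} \<Longrightarrow> a j * x + b j * y \<noteq> 0" by blast
  have "(\<Prod>j\<in>I - {i}. L j ^ m j) dvd g"
    by (rule prod_L_dvd) (use i dvd in auto)
  then have "(\<Sum>j\<in>I - {i}. m j) \<le> k"
    using homogeneous_poly_dvd_imp_le[OF homogeneous_poly_prod_L] \<open>homogeneous_poly k g\<close> \<open>g \<noteq> 0\<close>
    by blast
  with large[OF i(1)] show False by simp
qed

lemma bij_betw_nabla: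
  assumes \<theta>: "\<theta> \<in> D (\<lambda>i. m i + 1)" and jac: "jacobian \<theta> = Const c * Q m" "c \<noteq> 0"
  shows "bij_betw (\<lambda>\<phi>. nabla \<phi> \<theta>) UNIV (D m)"
  unfolding bij_betw_def
proof
  have nz: "jacobian \<theta> \<noteq> 0"
    using jac Q_nonzero by simp
  show "inj (\<lambda>\<phi>. nabla \<phi> \<theta>)"
  proof (rule injI)
    fix \<phi> \<psi> assume "nabla \<phi> \<theta> = nabla \<psi> \<theta>"
    then have "der_scale (fst \<phi> - fst \<psi>) (nabla (1, 0) \<theta>) + der_scale (snd \<phi> - snd \<psi>) (nabla (0, 1) \<theta>) = 0"
      by (subst (asm) (1 2) nabla_conv_der_scale) (simp add: der.scale_left_diff_distrib algebra_simps)
    from independent_if_der_det[OF nz[unfolded jacobian_def] this]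
    show "\<phi> = \<psi>" by (simp add: prod_eq_iff)
  qed
  show "range (\<lambda>\<phi>. nabla \<phi> \<theta>) = D m"
  proof (intro equalityI subsetI)
    fix \<xi> assume "\<xi> \<in> D m"
    then obtain s t where "\<xi> = der_scale s (nabla (1, 0) \<theta>) + der_scale t (nabla (0, 1) \<theta>)"
      using basis_if_der_det[OF jac[unfolded jacobian_def] nabla_in_D[OF \<theta>] nabla_in_D[OF \<theta>]] by blast
    then have "\<xi> = nabla (s, t) \<theta>"
      by (subst nabla_conv_der_scale) simp
    then show "\<xi> \<in> range (\<lambda>\<phi>. nabla \<phi> \<theta>)" by blast
  qed (use nabla_in_D[OF \<theta>] in auto)
qed

lemma jacobian_eq_Const_mult_Q:
  assumes "\<theta> \<in> D (\<lambda>i. m i + 1)" "homogeneous_pair k \<theta>" "jacobian \<theta> \<noteq> 0"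
    and "(\<Sum>i\<in>I. m i) = 2 * (k - 1)"
  shows "\<exists>c. c \<noteq> 0 \<and> jacobian \<theta> = Const c * Q m"
proof -
  have "Q m dvd jacobian \<theta>"
    unfolding jacobian_def using assms(1) by (intro Q_dvd_der_det nabla_in_D)
  then obtain r where r: "jacobian \<theta> = Q m * r"
    by (rule dvdE)
  have "homogeneous_poly (k - 1 + (k - 1) - (\<Sum>i\<in>I. m i)) r"
    using homogeneous_poly_cofactor[OF homogeneous_poly_Q, of "k - 1 + (k - 1)" m r]
      homogeneous_poly_jacobian[OF assms(2)] assms(3) r by simp
  then have "homogeneous_poly 0 r"
    using assms(4) by simp
  then obtain c where "r = Const c"
    using homogeneous_poly_0_imp_Const by blast
  then show ?thesis
    using r assms(3) by (intro exI[of _ c]) (auto simp: mult.commute)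
qed

text \<open>If every element of the module arises as \<open>\<nabla>\<^sub>\<phi>\<theta>\<close>, then the two derivations with \<open>\<phi> = \<partial>\<^sub>1\<close> and
  \<open>\<phi> = \<partial>\<^sub>2\<close> generate it, and Saito's criterion determines their determinant, the Jacobian.\<close>

lemma universal_imp_degree:
  assumes "\<theta> \<in> D (\<lambda>i. m i + 1)" "homogeneous_pair k \<theta>" "I \<noteq> {}"
    and surj: "D m \<subseteq> range (\<lambda>\<phi>. nabla \<phi> \<theta>)"
  shows "jacobian \<theta> \<noteq> 0" "k > 0" "(\<Sum>i\<in>I. m i) = 2 * (k - 1)"
proof -
  have gen: "\<exists>s t. \<xi> = der_scale s (nabla (1, 0) \<theta>) + der_scale t (nabla (0, 1) \<theta>)"
    if "\<xi> \<in> D m" for \<xi>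
  proof -
    obtain \<phi> where "\<xi> = nabla \<phi> \<theta>"
      using surj \<open>\<xi> \<in> D m\<close> by blast
    then show ?thesis by (subst (asm) nabla_conv_der_scale) blast
  qed
  note * = degree_sum_if_generators[OF gen nabla_in_D[OF assms(1)] nabla_in_D[OF assms(1)] assms(3)
      homogeneous_poly_jacobian[OF assms(2), unfolded jacobian_def]]
  show nz: "jacobian \<theta> \<noteq> 0"
    unfolding jacobian_def by (rule *)
  show "k > 0"
    by (rule degree_pos_if_jacobian_nonzero[OF assms(2) nz])
  show "(\<Sum>i\<in>I. m i) = 2 * (k - 1)"
    using *(2) by simp
qed

text \<open>The derivation \<open>tangent m i\<close> has the degree \<open>\<Sum>j\<in>I - {i}. m j\<close>.  It is independent of one of the
  derivations \<open>\<nabla>\<^sub>\<phi>\<theta>\<close> with \<open>\<phi> = \<partial>\<^sub>1\<close> or \<open>\<phi> = \<partial>\<^sub>2\<close>, so the determinant of the two is a nonzero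
  multiple of \<open>Q m\<close> and its degree is at least \<open>2 (k - 1)\<close>.\<close>

lemma balanced_if_jacobian_nonzero:
  assumes \<theta>: "\<theta> \<in> D (\<lambda>i. m i + 1)" "homogeneous_pair k \<theta>"
    and nz: "jacobian \<theta> \<noteq> 0" and sum: "(\<Sum>i\<in>I. m i) = 2 * (k - 1)" and i: "i \<in> I"
  shows "m i \<le> (\<Sum>j\<in>I - {i}. m j)"
proof -
  let ?\<tau> = "tangent m i"
  have "R m i \<noteq> 0"
    by (simp add: R_def L_nonzero)
  then have "?\<tau> \<noteq> 0"
    using nonzero[OF i] by (auto simp: tangent_def zero_prod_def)
  have hom: "homogeneous_pair (\<Sum>j\<in>I - {i}. m j) ?\<tau>"
    using homogeneous_poly_mult[OF homogeneous_poly_prod_L homogeneous_poly_Const]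
    by (fastforce simp: homogeneous_pair_def tangent_def R_def intro: homogeneous_poly_uminus)
  have le: ?thesis if \<phi>: "\<phi> = (1, 0) \<or> \<phi> = (0, 1)" "der_det ?\<tau> (nabla \<phi> \<theta>) \<noteq> 0" for \<phi>
  proof -
    have "homogeneous_pair 0 \<phi>"
      using \<phi> by (auto simp: homogeneous_pair_def homogeneous_poly_1)
    then have "homogeneous_pair (k - 1) (nabla \<phi> \<theta>)"
      using homogeneous_pair_nabla[OF _ \<theta>(2)] by fastforce
    then have "(\<Sum>i\<in>I. m i) \<le> (\<Sum>j\<in>I - {i}. m j) + (k - 1)"
      using homogeneous_poly_dvd_imp_le[OF homogeneous_poly_Q homogeneous_poly_der_det[OF hom]
          Q_dvd_der_det[OF tangent_in_D[OF i] nabla_in_D[OF \<theta>(1)]] \<phi>(2)] by blast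
    moreover have "(\<Sum>i\<in>I. m i) = m i + (\<Sum>j\<in>I - {i}. m j)"
      using i by (simp add: sum.remove)
    ultimately show ?thesis using sum by linarith
  qed
  have "der_det ?\<tau> (nabla (1, 0) \<theta>) \<noteq> 0 \<or> der_det ?\<tau> (nabla (0, 1) \<theta>) \<noteq> 0"
  proof (rule ccontr)
    assume "\<not> ?thesis"
    then have z: "der_det ?\<tau> (nabla (1, 0) \<theta>) = 0" "der_det ?\<tau> (nabla (0, 1) \<theta>) = 0" by simp_all
    have "der_scale (jacobian \<theta>) ?\<tau> =
        der_scale (der_det ?\<tau> (nabla (0, 1) \<theta>)) (nabla (1, 0) \<theta>)
        - der_scale (der_det ?\<tau> (nabla (1, 0) \<theta>)) (nabla (0, 1) \<theta>)"
      by (simp add: jacobian_def der_scale_def der_det_def prod_eq_iff algebra_simps)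
    then have "der_scale (jacobian \<theta>) ?\<tau> = 0"
      by (simp add: z)
    then show False
      using nz \<open>?\<tau> \<noteq> 0\<close> by (auto simp: der_scale_def prod_eq_iff)
  qed
  then show ?thesis using le by blast
qed

text \<open>Up to the factor \<open>k\<close>, the derivation \<open>\<theta>\<close> is the image of the Euler derivation, so the
  determinant is the Jacobian times that of the Euler derivation and \<open>gradient_perp\<close>.\<close>

lemma der_det_gradient_perp:
  assumes "homogeneous_pair k \<theta>" "k > 0" "jacobian \<theta> = Const c * Q m" "c \<noteq> 0" "I \<noteq> {}"
  shows "\<exists>c'. c' \<noteq> 0 \<and> der_det \<theta> (nabla gradient_perp \<theta>) = Const c' * Q (\<lambda>i. m i + 1)"
proof (intro exI conjI)
  let ?c = "- (of_nat (card I) * c / of_nat k)"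
  show "?c \<noteq> 0" using assms by simp
  have "of_nat k * der_det \<theta> (nabla gradient_perp \<theta>) = der_det (nabla euler \<theta>) (nabla gradient_perp \<theta>)"
    by (simp add: nabla_euler[OF assms(1)] der_det_def der_scale_def algebra_simps)
  also have "\<dots> = - of_nat (card I) * Const c * Q (\<lambda>i. m i + 1)"
    by (simp add: der_det_nabla der_det_euler_gradient_perp assms(3)
        Q_Suc[of m, simplified] ac_simps)
  also have "\<dots> = Const (- (of_nat (card I) * c)) * Q (\<lambda>i. m i + 1)"
    by (simp only: Const_uminus Const_mult Const_of_nat mult_minus_left)
  also have "- (of_nat (card I) * c) = of_nat k * ?c"
    using assms by simp
  also have "Const (of_nat k * ?c) * Q (\<lambda>i. m i + 1) = of_nat k * (Const ?c * Q (\<lambda>i. m i + 1))"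
    by (simp only: Const_mult Const_of_nat mult.assoc)
  finally show "der_det \<theta> (nabla gradient_perp \<theta>) = Const ?c * Q (\<lambda>i. m i + 1)"
    using assms(2) by simp
qed

end

section \<open>Arrangements in a coordinate plane\<close>

lemma der_span_pair:
  "der.span {\<eta>1, \<eta>2} = {der_scale s \<eta>1 + der_scale t \<eta>2 | s t. True}"
proof -
  have "\<xi> \<in> der.span {\<eta>1, \<eta>2} \<longleftrightarrow> (\<exists>s t. \<xi> = der_scale s \<eta>1 + der_scale t \<eta>2)" for \<xi>
    by (simp add: der.span_breakdown_eq der.span_singleton image_iff diff_eq_eq add.commute)
  then show ?thesis by blast
qed

lemma image_mset_pairE:
  assumes "{#p, q#} = image_mset f (mset_set B)" "finite B"
  obtains x y where "B = {x, y}" "f x + f y = p + (q :: nat)"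
proof -
  have "card B = 2"
    using arg_cong[OF assms(1), of size] assms(2) by simp
  then obtain x y where xy: "B = {x, y}" "x \<noteq> y"
    by (meson card_2_iff)
  moreover have "f x + f y = p + q"
    using arg_cong[OF assms(1), of sum_mset] xy by simp
  ultimately show ?thesis using that by blast
qed

context coordinate_plane
begin

lemma form_poly_eq_lin: "form_poly f = lin (f e1) (f e2)"
  by (simp add: form_poly_def lin_def)

lemma coordinates: "\<exists>x y. v = scale x e1 + scale y e2"
proof -
  have "v \<in> span {e1, e2}" by (simp add: span_basis)
  then show ?thesis
    by (simp add: span_breakdown_eq span_singleton image_iff diff_eq_eq add.commute)
qed

lemma linear_form_coordinates:
  assumes "linear_form f"
  shows "f (scale x e1 + scale y e2) = x * f e1 + y * f e2"
proof -
  interpret Vector_Spaces.linear scale "(*)" f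
    using assms by (simp add: linear_form_def)
  show ?thesis by (simp add: add scale)
qed

lemma ex_linear_form: "\<exists>f. linear_form f \<and> f e1 = x \<and> f e2 = y"
proof -
  interpret vs: vector_space "(*) :: 'k \<Rightarrow> 'k \<Rightarrow> 'k"
    by unfold_locales (simp_all add: algebra_simps)
  interpret vector_space_pair scale "(*) :: 'k \<Rightarrow> 'k \<Rightarrow> 'k" ..
  obtain g where "Vector_Spaces.linear scale (*) g" "\<forall>v\<in>{e1, e2}. g v = (if v = e1 then x else y)"
    using linear_independent_extend[OF independent_basis, of "\<lambda>v. if v = e1 then x else y"] by blast
  then show ?thesis
    using distinct_basis by (auto simp: linear_form_def)
qed

lemma homogeneous_der_iff: "homogeneous_der \<theta> k \<longleftrightarrow> \<theta> \<noteq> 0 \<and> homogeneous_pair k \<theta>"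
proof
  assume hom: "homogeneous_der \<theta> k"
  have *: "homogeneous_poly k (Const x * fst \<theta> + Const y * snd \<theta>)" for x y
  proof -
    obtain f where f: "linear_form f" "f e1 = x" "f e2 = y"
      using ex_linear_form by blast
    have "homogeneous_poly k (der_apply \<theta> (form_poly f))"
      using hom f(1) by (cases "der_apply \<theta> (form_poly f) = 0") (auto simp: homogeneous_der_def)
    then show ?thesis
      by (simp add: form_poly_eq_lin der_apply_lin f)
  qed
  show "\<theta> \<noteq> 0 \<and> homogeneous_pair k \<theta>"
    using hom *[of 1 0] *[of 0 1] by (simp add: homogeneous_der_def homogeneous_pair_def)
next
  assume "\<theta> \<noteq> 0 \<and> homogeneous_pair k \<theta>"
  then show "homogeneous_der \<theta> k"
    by (simp add: homogeneous_der_def homogeneous_pair_def form_poly_eq_lin der_apply_lin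
        homogeneous_poly_add homogeneous_poly_Const_mult)
qed

lemma line_family_arrangement:
  assumes arr: "arrangement UNIV \<A>" and forms: "defining_forms \<A> \<alpha>"
  shows "line_family \<A> (\<lambda>H. \<alpha> H e1) (\<lambda>H. \<alpha> H e2)"
proof
  show "finite \<A>" using arr by (simp add: arrangement_def)
next
  have lin: "linear_form (\<alpha> H)" and ker: "{v. \<alpha> H v = 0} = H" if "H \<in> \<A>" for H
    using forms that by (auto simp: defining_forms_def)
  have mem: "scale x e1 + scale y e2 \<in> H \<longleftrightarrow> x * \<alpha> H e1 + y * \<alpha> H e2 = 0" if "H \<in> \<A>" for H x y
    using ker[OF that] linear_form_coordinates[OF lin[OF that]] by (metis mem_Collect_eq)
  have nz: "\<alpha> H e1 \<noteq> 0 \<or> \<alpha> H e2 \<noteq> 0" if "H \<in> \<A>" for H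
  proof (rule ccontr)
    assume "\<not> ?thesis"
    then have "v \<in> H" for v
      using mem[OF that] coordinates[of v] by auto
    then have "H = UNIV" by blast
    then show False
      using arr that by (auto simp: arrangement_def hyperplane_of_def)
  qed
  then show "\<alpha> H e1 \<noteq> 0 \<or> \<alpha> H e2 \<noteq> 0" if "H \<in> \<A>" for H
    using that .
  have sub: "H \<subseteq> H'" if HH': "H \<in> \<A>" "H' \<in> \<A>" and eq: "\<alpha> H e1 * \<alpha> H' e2 = \<alpha> H' e1 * \<alpha> H e2" for H H'
  proof
    fix v assume "v \<in> H"
    obtain x y where v: "v = scale x e1 + scale y e2"
      using coordinates by blast
    have h: "x * \<alpha> H e1 + y * \<alpha> H e2 = 0"
      using \<open>v \<in> H\<close> mem[OF HH'(1)] v by simp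
    have "\<alpha> H e1 * (x * \<alpha> H' e1 + y * \<alpha> H' e2) = \<alpha> H' e1 * (x * \<alpha> H e1 + y * \<alpha> H e2)"
      using arg_cong[OF eq, of "\<lambda>t. y * t"] by (simp add: algebra_simps)
    moreover have "\<alpha> H e2 * (x * \<alpha> H' e1 + y * \<alpha> H' e2) = \<alpha> H' e2 * (x * \<alpha> H e1 + y * \<alpha> H e2)"
      using arg_cong[OF eq, of "\<lambda>t. x * t"] by (simp only: algebra_simps)
    ultimately have "x * \<alpha> H' e1 + y * \<alpha> H' e2 = 0"
      using nz[OF HH'(1)] h by auto
    then show "v \<in> H'" using mem[OF HH'(2)] v by simp
  qed
  show "\<alpha> H e1 * \<alpha> H' e2 \<noteq> \<alpha> H' e1 * \<alpha> H e2" if "H \<in> \<A>" "H' \<in> \<A>" "H \<noteq> H'" for H H'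
  proof
    assume eq: "\<alpha> H e1 * \<alpha> H' e2 = \<alpha> H' e1 * \<alpha> H e2"
    then have "H \<subseteq> H'" "H' \<subseteq> H"
      using sub that by (metis mult.commute)+
    with that show False by blast
  qed
qed

text \<open>The characterization for any arrangement of at least three lines; with this bound,
  \<open>d + (d + card \<A> - 2)\<close>, the sum of the exponents, is larger than \<open>2 d\<close>.\<close>

lemma universal_iff_balanced_exponents:
  assumes arr: "arrangement UNIV \<A>" and forms: "defining_forms \<A> \<alpha>" and card: "card \<A> \<ge> 3"
    and log: "\<theta> \<in> log_der \<A> \<alpha> (\<lambda>H. m H + 1)" and hom: "homogeneous_der \<theta> d"
  shows "universal_der \<A> \<alpha> m \<theta> \<longleftrightarrow>
    balanced \<A> (\<lambda>H. m H + 1) \<and> has_exponents \<A> \<alpha> (\<lambda>H. m H + 1) {#d, d + card \<A> - 2#}"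
proof -
  interpret line_family \<A> "\<lambda>H. \<alpha> H e1" "\<lambda>H. \<alpha> H e2"
    by (rule line_family_arrangement[OF arr forms])
  have log_der_eq: "log_der \<A> \<alpha> k = D k" for k
    by (simp add: log_der_def D_def L_def form_poly_eq_lin)
  have ne: "\<A> \<noteq> {}" using card by auto
  have \<theta>: "\<theta> \<in> D (\<lambda>H. m H + 1)" "homogeneous_pair d \<theta>" "\<theta> \<noteq> 0"
    using log hom by (simp_all add: log_der_eq homogeneous_der_iff)
  have sum_Suc: "(\<Sum>H\<in>A. m H + 1) = (\<Sum>H\<in>A. m H) + card A" for A
    by (simp only: sum.distrib card_eq_sum)
  show ?thesis
  proof
    assume "universal_der \<A> \<alpha> m \<theta>"
    then have "D m \<subseteq> range (\<lambda>\<phi>. nabla \<phi> \<theta>)"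
      by (auto simp: universal_der_def log_der_eq bij_betw_def)
    note * = universal_imp_degree[OF \<theta>(1,2) ne this]
    have "balanced \<A> (\<lambda>H. m H + 1)"
      unfolding balanced_def
    proof
      fix H assume H: "H \<in> \<A>"
      have "m H \<le> (\<Sum>H'\<in>\<A> - {H}. m H')"
        by (rule balanced_if_jacobian_nonzero[OF \<theta>(1,2) *(1,3) H])
      moreover have "card (\<A> - {H}) \<ge> 1"
        using card H by simp
      ultimately show "m H + 1 \<le> (\<Sum>H'\<in>\<A> - {H}. m H' + 1)"
        unfolding sum_Suc by linarith
    qed
    moreover have "has_exponents \<A> \<alpha> (\<lambda>H. m H + 1) {#d, d + card \<A> - 2#}"
    proof -
      define \<eta> where "\<eta> = nabla gradient_perp \<theta>"
      obtain c0 where "c0 \<noteq> 0" "jacobian \<theta> = Const c0 * Q m"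
        using jacobian_eq_Const_mult_Q[OF \<theta>(1,2) *(1,3)] by blast
      then obtain c where c: "c \<noteq> 0" "der_det \<theta> \<eta> = Const c * Q (\<lambda>H. m H + 1)"
        unfolding \<eta>_def using der_det_gradient_perp[OF \<theta>(2) *(2) _ _ ne] by blast
      then have nz: "der_det \<theta> \<eta> \<noteq> 0"
        using Q_nonzero by simp
      have \<eta>: "\<eta> \<in> D (\<lambda>H. m H + 1)"
        unfolding \<eta>_def by (rule nabla_in_D_log[OF gradient_perp_in_D \<theta>(1)])
      have "\<eta> \<noteq> 0" "\<eta> \<noteq> \<theta>"
        using nz by (auto simp: der_det_def)
      have "homogeneous_pair (card \<A> - 1 + (d - 1)) \<eta>"
        unfolding \<eta>_def by (rule homogeneous_pair_nabla[OF homogeneous_pair_gradient_perp \<theta>(2)])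
      also have "card \<A> - 1 + (d - 1) = d + card \<A> - 2"
        using *(2) card by simp
      finally have \<eta>_hom: "homogeneous_der \<eta> (d + card \<A> - 2)"
        using \<open>\<eta> \<noteq> 0\<close> by (simp add: homogeneous_der_iff)
      have "der.span {\<theta>, \<eta>} = D (\<lambda>H. m H + 1)"
        unfolding der_span_pair
        using basis_if_der_det[OF c(2,1) \<theta>(1) \<eta>] \<theta>(1) \<eta> by (blast intro: D_add D_scale)
      moreover have "der.independent {\<theta>, \<eta>}"
      proof -
        have "u \<theta> = 0 \<and> u \<eta> = 0" if "(\<Sum>v\<in>{\<theta>, \<eta>}. der_scale (u v) v) = 0" for u
          using that \<open>\<eta> \<noteq> \<theta>\<close> independent_if_der_det[OF nz, of "u \<theta>" "u \<eta>"] by simp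
        then show ?thesis
          by (subst der.dependent_finite) auto
      qed
      moreover have "{#d, d + card \<A> - 2#} =
          image_mset (\<lambda>v. if v = \<theta> then d else d + card \<A> - 2) (mset_set {\<theta>, \<eta>})"
        using \<open>\<eta> \<noteq> \<theta>\<close> by simp
      ultimately show ?thesis
        unfolding has_exponents_def log_der_eq
        using hom \<eta>_hom
        by (intro exI[of _ "{\<theta>, \<eta>}"] exI[of _ "\<lambda>v. if v = \<theta> then d else d + card \<A> - 2"]) simp
    qed
    ultimately show "balanced \<A> (\<lambda>H. m H + 1) \<and> has_exponents \<A> \<alpha> (\<lambda>H. m H + 1) {#d, d + card \<A> - 2#}" ..
  next
    assume asm: "balanced \<A> (\<lambda>H. m H + 1) \<and> has_exponents \<A> \<alpha> (\<lambda>H. m H + 1) {#d, d + card \<A> - 2#}"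
    then obtain B \<delta> where B: "finite B" "der.span B = D (\<lambda>H. m H + 1)"
        "\<And>\<eta>. \<eta> \<in> B \<Longrightarrow> homogeneous_der \<eta> (\<delta> \<eta>)" "{#d, d + card \<A> - 2#} = image_mset \<delta> (mset_set B)"
      unfolding has_exponents_def log_der_eq by blast
    obtain \<eta>1 \<eta>2 where \<eta>: "B = {\<eta>1, \<eta>2}" "\<delta> \<eta>1 + \<delta> \<eta>2 = d + (d + card \<A> - 2)"
      using image_mset_pairE[OF B(4,1)] by blast
    have "\<exists>s t. \<xi> = der_scale s \<eta>1 + der_scale t \<eta>2" if "\<xi> \<in> D (\<lambda>H. m H + 1)" for \<xi>
      using that B(2) by (auto simp: \<eta> der_span_pair)
    moreover have "\<eta>1 \<in> D (\<lambda>H. m H + 1)" "\<eta>2 \<in> D (\<lambda>H. m H + 1)"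
      using B(2) der.span_superset[of B] by (auto simp: \<eta>)
    moreover have "homogeneous_poly (\<delta> \<eta>1 + \<delta> \<eta>2) (der_det \<eta>1 \<eta>2)"
      using B(3) by (intro homogeneous_poly_der_det) (simp_all add: \<eta> homogeneous_der_iff)
    ultimately have "\<delta> \<eta>1 + \<delta> \<eta>2 = (\<Sum>H\<in>\<A>. m H + 1)"
      using degree_sum_if_generators(2) ne by blast
    then have sum: "(\<Sum>H\<in>\<A>. m H) + 2 = 2 * d"
      using \<eta>(2) card unfolding sum_Suc by linarith
    have "jacobian \<theta> \<noteq> 0"
    proof (rule jacobian_nonzero_if_large_multiplicities[OF \<theta> _ _ ne])
      show "d > 0" using sum by simp
      fix H assume H: "H \<in> \<A>"
      have "m H + 1 \<le> (\<Sum>H'\<in>\<A> - {H}. m H' + 1)"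
        using asm H by (simp add: balanced_def)
      moreover have "(\<Sum>H\<in>\<A>. m H + 1) = (m H + 1) + (\<Sum>H'\<in>\<A> - {H}. m H' + 1)"
        using H by (subst sum.remove[of _ H]) simp_all
      ultimately show "d < (\<Sum>H'\<in>\<A> - {H}. m H' + 1)"
        using sum card unfolding sum_Suc[of \<A>] by linarith
    qed
    then obtain c where "c \<noteq> 0" "jacobian \<theta> = Const c * Q m"
      using jacobian_eq_Const_mult_Q[OF \<theta>(1,2)] sum by force
    then have "bij_betw (\<lambda>\<phi>. nabla \<phi> \<theta>) UNIV (D m)"
      using bij_betw_nabla[OF \<theta>(1)] by blast
    then show "universal_der \<A> \<alpha> m \<theta>"
      using hom log module_hom_nabla[of \<theta>] by (auto simp: universal_der_def log_der_eq)
  qed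
qed

end

theorem theorem1p3:
  fixes scale :: "'k::field_char_0 \<Rightarrow> 'v::ab_group_add \<Rightarrow> 'v"
    and e1 e2 :: 'v
    and \<A> :: "'v set set"
    and \<alpha> :: "'v set \<Rightarrow> 'v \<Rightarrow> 'k"
    and m :: "'v set \<Rightarrow> nat"
    and \<theta> :: "'k der"
    and d :: nat
  assumes "coordinate_plane scale e1 e2"
    and "arrangement_space.irreducible_arrangement scale \<A>"
    and "arrangement_space.defining_forms scale \<A> \<alpha>"
    and "card \<A> > 3 \<or> (card \<A> = 3 \<and> balanced \<A> m)"
    and "\<theta> \<in> coordinate_plane.log_der e1 e2 \<A> \<alpha> (\<lambda>H. m H + 1)"
    and "coordinate_plane.homogeneous_der scale e1 e2 \<theta> d"
  shows "coordinate_plane.universal_der scale e1 e2 \<A> \<alpha> m \<theta> \<longleftrightarrow>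
         balanced \<A> (\<lambda>H. m H + 1) \<and>
         coordinate_plane.has_exponents scale e1 e2 \<A> \<alpha> (\<lambda>H. m H + 1)
           {#d, d + card \<A> - 2#}"
proof -
  interpret coordinate_plane scale e1 e2 by fact
  show ?thesis
    using assms(2-) by (intro universal_iff_balanced_exponents) (auto simp: irreducible_arrangement_def)
qed

end
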